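(* Let $k\ge 1$ be an integer and let $(\xi(s))_{s\in\mathbb{Z}}$ be a stationary sequence of real random variables such that, for every $\tau>0$, with $u_n=u_n^{(\tau)}$, the sequence $(\xi(s))_{s\in\mathbb{Z}}$ satisfies the $D^{(k)}(u_n)$ condition and the sequence $(\xi(S_n))_{n\ge 0}$ satisfies the $\Delta(u_n)$ condition. Assume that the extremal index of $(\xi(s))_{s\in\mathbb{Z}}$ exists and is equal to $\sigma\in(0,1]$, i.e. for every $\tau>0$, with $u_n=u_n^{(\tau)}$, $$n\,\mathbb{P}(\xi(0)>u_n)\to\tau\quad\text{and}\quad \mathbb{P}\Big(\max_{0\le s\le n}\xi(s)\le u_n\Big)\to e^{-\sigma\tau}\qquad (n\to\infty).$$ Then the sequence $(\xi(S_n))_{n\ge 0}$ admits an extremal index, equal to $\theta=\sigma q$; i.e. for every $\tau>0$, with $u_n=u_n^{(\tau)}$, $$\mathbb{P}\Big(\max_{0\le i\le n}\xi(S_i)\le u_n\Big)\to e^{-\sigma q\tau}\qquad (n\to\infty).$$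
   Context: Random walk: $S_0=0$, $S_n=X_1+\cdots+X_n$ for $n\ge1$, where $(X_i)_{i\ge1}$ are independent with $\mathbb{P}(X_i=1)=p$, $\mathbb{P}(X_i=-1)=1-p$, $p\in(0,1)\setminus\{1/2\}$. The sequence $(\xi(s))_{s\in\mathbb{Z}}$ is independent of $(X_i)_{i\ge1}$. Set $q=\mathbb{P}(S_i\ne0\ \forall i\ge1)$ (one has $q=|2p-1|$). Thresholds: it is assumed that for every $\tau>0$ there is a sequence of positive numbers $u_n=u_n^{(\tau)}$ with $n\,\mathbb{P}(\xi(0)>u_n)\to\tau$; these sequences are fixed. $\Delta(u_n)$ condition: let $(u_n)_{n\ge 0}$ be a sequence of positive numbers and let $(\zeta(s))$ be a stationary sequence (indexed by $\mathbb{Z}$ or by the nonnegative integers). For $0\le m_1\le m_2\le n$ let $\mathcal{B}_{m_1}^{m_2}(u_n)$ be the $\sigma$-field generated by the events $\{\zeta(s)\le u_n\}$, $m_1\le s\le m_2$, and for $1\le\ell\le n-1$ let $$\alpha_{n,\ell}=\max_{1\le j\le n-\ell}\ \max_{A\in\mathcal{B}_0^j(u_n),\,B\in\mathcal{B}_{j+\ell}^n(u_n)}|\mathbb{P}(A\cap B)-\mathbb{P}(A)\mathbb{P}(B)|.$$ The sequence $(\zeta(s))$ satisfies $\Delta(u_n)$ if there is a sequence $(\ell_n)$ with $\alpha_{n,\ell_n}\to0$ and $\ell_n=o(n)$. For $(\xi(S_n))_{n\ge0}$ this is applied with $\zeta(i)=\xi(S_i)$. $D^{(k)}(u_n)$ condition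 ($k\ge1$): $(\zeta(s))$ satisfies $\Delta(u_n)$ and there exist sequences of integers $(s_n)$, $(\ell_n)$ such that $s_n\to\infty$, $s_n\alpha_{n,\ell_n}\to0$, $s_n\ell_n/n\to0$ and $$\lim_{n\to\infty}n\,\mathbb{P}\big(\zeta(0)>u_n\ge M_{1,k-1},\ M_{k,r_n}>u_n\big)=0,$$ where $r_n=\lfloor n/s_n\rfloor$, $M_{i,j}=\max_{i\le t\le j}\zeta(t)$ for $0\le i\le j$, and $M_{i,j}=-\infty$ for $i>j$. *)

theory Defs
  imports "HOL-Probability.Probability"
begin

definition stationary :: "'a measure \<Rightarrow> (int \<Rightarrow> 'a \<Rightarrow> real) \<Rightarrow> bool" where
  "stationary M \<xi> \<longleftrightarrow>
     (\<forall>s. \<xi> s \<in> borel_measurable M) \<and>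
     (\<forall>h. distr M (Pi\<^sub>M UNIV (\<lambda>_. borel)) (\<lambda>\<omega> s. \<xi> (s + h) \<omega>)
        = distr M (Pi\<^sub>M UNIV (\<lambda>_. borel)) (\<lambda>\<omega> s. \<xi> s \<omega>))"

text \<open>Independence of the two families, i.e. of the \<open>\<sigma>\<close>-fields they generate
  (the library's \<open>indep_var\<close> needs both variables to have the same type).
  The steps are indexed by \<open>i \<ge> 1\<close>.\<close>

definition indep_scenery :: "'a measure \<Rightarrow> (int \<Rightarrow> 'a \<Rightarrow> real) \<Rightarrow> (nat \<Rightarrow> 'a \<Rightarrow> int) \<Rightarrow> bool" where
  "indep_scenery M \<xi> X \<longleftrightarrow>
     prob_space.indep_set M
       (sets (vimage_algebra (space M) (\<lambda>\<omega> s. \<xi> s \<omega>) (Pi\<^sub>M UNIV (\<lambda>_. borel))))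
       (sets (vimage_algebra (space M) (\<lambda>\<omega>. \<lambda>i\<in>{1..}. X i \<omega>) (Pi\<^sub>M {1..} (\<lambda>_. count_space UNIV))))"

definition walk :: "(nat \<Rightarrow> 'a \<Rightarrow> int) \<Rightarrow> nat \<Rightarrow> 'a \<Rightarrow> int" where
  "walk X n \<omega> = (\<Sum>i=1..n. X i \<omega>)"

text \<open>The mixing conditions only involve the variables with nonnegative index, so they are
  stated for sequences indexed by \<open>nat\<close>; a sequence \<open>\<xi>\<close> indexed by \<open>int\<close> enters
  as \<open>\<lambda>i. \<xi> (int i)\<close>.\<close>

text \<open>\<open>M\<^sub>i\<^sub>,\<^sub>j\<close>, valued in \<open>ereal\<close> so that it is \<open>-\<infinity>\<close> for \<open>i > j\<close>.\<close>

definition run_max :: "(nat \<Rightarrow> 'a \<Rightarrow> real) \<Rightarrow> nat \<Rightarrow> nat \<Rightarrow> 'a \<Rightarrow> ereal" where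
  "run_max \<zeta> i j \<omega> = (SUP t\<in>{i..j}. ereal (\<zeta> t \<omega>))"

definition level_field ::
    "'a measure \<Rightarrow> (nat \<Rightarrow> 'a \<Rightarrow> real) \<Rightarrow> real \<Rightarrow> nat \<Rightarrow> nat \<Rightarrow> 'a set set" where
  "level_field M \<zeta> v m1 m2 =
     sigma_sets (space M) ((\<lambda>s. {\<omega> \<in> space M. \<zeta> s \<omega> \<le> v}) ` {m1..m2})"

text \<open>Only meaningful for \<open>1 \<le> l \<le> n - 1\<close>. The supremum is then a maximum, since the
  \<open>\<sigma>\<close>-fields are finitely generated, hence finite.\<close>

definition mixing_coeff ::
    "'a measure \<Rightarrow> (nat \<Rightarrow> 'a \<Rightarrow> real) \<Rightarrow> (nat \<Rightarrow> real) \<Rightarrow> nat \<Rightarrow> nat \<Rightarrow> real" where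
  "mixing_coeff M \<zeta> u n l =
     Sup {\<bar>measure M (A \<inter> B) - measure M A * measure M B\<bar> | j A B.
            1 \<le> j \<and> j \<le> n - l \<and>
            A \<in> level_field M \<zeta> (u n) 0 j \<and> B \<in> level_field M \<zeta> (u n) (j + l) n}"

text \<open>In the next two definitions the gaps \<open>l n\<close> have to lie in the range where the mixing
  coefficient is defined; this range is empty for \<open>n \<le> 1\<close>, hence ``eventually''.\<close>

definition Delta_cond ::
    "'a measure \<Rightarrow> (nat \<Rightarrow> 'a \<Rightarrow> real) \<Rightarrow> (nat \<Rightarrow> real) \<Rightarrow> bool" where
  "Delta_cond M \<zeta> u \<longleftrightarrow>
     (\<exists>l :: nat \<Rightarrow> nat.
        (\<forall>\<^sub>F n in sequentially. 1 \<le> l n \<and> l n < n) \<and>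
        (\<lambda>n. mixing_coeff M \<zeta> u n (l n)) \<longlonglongrightarrow> 0 \<and>
        (\<lambda>n. real (l n)) \<in> o(\<lambda>n. real n))"

definition D_cond ::
    "nat \<Rightarrow> 'a measure \<Rightarrow> (nat \<Rightarrow> 'a \<Rightarrow> real) \<Rightarrow> (nat \<Rightarrow> real) \<Rightarrow> bool" where
  "D_cond k M \<zeta> u \<longleftrightarrow>
     Delta_cond M \<zeta> u \<and>
     (\<exists>(s :: nat \<Rightarrow> nat) (l :: nat \<Rightarrow> nat).
        (\<forall>\<^sub>F n in sequentially. 1 \<le> l n \<and> l n < n) \<and>
        filterlim s at_top sequentially \<and>
        (\<lambda>n. real (s n) * mixing_coeff M \<zeta> u n (l n)) \<longlonglongrightarrow> 0 \<and>
        (\<lambda>n. real (s n) * real (l n) / real n) \<longlonglongrightarrow> 0 \<and>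
        (\<lambda>n. real n * measure M {\<omega> \<in> space M.
             \<zeta> 0 \<omega> > u n \<and> ereal (u n) \<ge> run_max \<zeta> 1 (k - 1) \<omega> \<and>
             run_max \<zeta> k (n div s n) \<omega> > ereal (u n)}) \<longlonglongrightarrow> 0)"

end

theory Submission
  imports Defs
begin

text \<open>The walk moves by \<open>\<plusminus>1\<close>, so the set \<open>R\<^sub>n\<close> of sites visited up to time \<open>n\<close> is an interval. By
  independence and stationarity the probability in question is therefore the expectation of
  \<open>P (\<xi>(s) \<le> u\<^sub>n for 0 \<le> s < m)\<close> at \<open>m = |R\<^sub>n|\<close>. The strong law gives \<open>|R\<^sub>n| / n \<rightarrow> |2p - 1|\<close> almost surely;
  comparing with the expected number of last visits, which is asymptotic to \<open>q n\<close>, identifies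
  this limit as \<open>q\<close>. Finally, if \<open>m / n \<rightarrow> c\<close>, then \<open>u\<^sub>n\<close> at level \<open>\<tau>\<close> may be replaced by \<open>u\<^sub>m\<close> at level
  \<open>c \<tau>\<close>, because \<open>m\<close> times the difference of the exceedance probabilities vanishes; so the
  probability tends to \<open>exp (-\<sigma> c \<tau>)\<close>, and dominated convergence concludes.\<close>

section \<open>Averages, and ranges of deterministic nearest-neighbour paths\<close>

lemma LIMSEQ_Cesaro_mean:
  fixes a :: "nat \<Rightarrow> real"
  assumes "a \<longlonglongrightarrow> L"
  shows "(\<lambda>n. (\<Sum>m<n. a m) / real n) \<longlonglongrightarrow> L"
proof (rule LIMSEQ_I)
  fix e :: real assume "0 < e"
  then obtain N where N: "\<And>n. n \<ge> N \<Longrightarrow> \<bar>a n - L\<bar> < e / 2"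
    using LIMSEQ_D[OF assms, of "e / 2"] by auto
  define C where "C = (\<Sum>m<N. \<bar>a m - L\<bar>)"
  \<comment> \<open>For \<open>n \<ge> K\<close> the first \<open>N\<close> terms contribute at most
    \<open>C < n * e / 2\<close>; the maximum with 0 forces \<open>n \<ge> 1\<close>.\<close>
  obtain K :: nat where K: "real K > max (2 * C / e) 0"
    using reals_Archimedean2 by blast
  show "\<exists>no. \<forall>n\<ge>no. norm ((\<Sum>m<n. a m) / real n - L) < e"
  proof (intro exI[of _ K] allI impI)
    fix n assume "n \<ge> K"
    hence n: "real n > 2 * C / e" "n \<ge> 1" using K by auto
    have "\<bar>(\<Sum>m<n. a m) - real n * L\<bar> = \<bar>\<Sum>m<n. a m - L\<bar>"
      by (simp add: sum_subtractf)
    also have "\<dots> \<le> (\<Sum>m<n. \<bar>a m - L\<bar>)" by (rule sum_abs)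
    also have "\<dots> \<le> (\<Sum>m<n. (if m < N then \<bar>a m - L\<bar> else 0) + e / 2)"
      using N \<open>0 < e\<close> by (intro sum_mono) (auto simp: not_less less_imp_le)
    also have "\<dots> = (\<Sum>m\<in>{..<n} \<inter> {..<N}. \<bar>a m - L\<bar>) + real n * (e / 2)"
      by (simp add: sum.distrib sum.inter_restrict lessThan_def)
    also have "(\<Sum>m\<in>{..<n} \<inter> {..<N}. \<bar>a m - L\<bar>) \<le> C"
      unfolding C_def by (intro sum_mono2) auto
    also have "C < real n * (e / 2)"
      using n \<open>0 < e\<close> by (simp add: field_simps)
    finally have "\<bar>(\<Sum>m<n. a m) - real n * L\<bar> < e * real n" by simp
    moreover have "(\<Sum>m<n. a m) / real n - L = ((\<Sum>m<n. a m) - real n * L) / real n"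
      using n by (simp add: field_simps)
    ultimately show "norm ((\<Sum>m<n. a m) / real n - L) < e"
      using n by (simp add: abs_divide divide_less_eq)
  qed
qed

text \<open>Each value has exactly one last visit before time \<open>n\<close>, so \<open>f\<close>
  maps the last-visit times bijectively onto the image. Last visits are counted because, for a walk,
  being a last visit at time \<open>i\<close> depends only on the steps after
  \<open>i\<close>.\<close>

lemma card_image_eq_card_last_visits:
  fixes f :: "nat \<Rightarrow> 'b"
  shows "card (f ` {..n}) = card {i \<in> {..n}. \<forall>j\<in>{i<..n}. f j \<noteq> f i}"
proof -
  define A where "A = {i \<in> {..n}. \<forall>j\<in>{i<..n}. f j \<noteq> f i}"
  have "inj_on f A"
  proof (rule inj_onI)
    fix i j assume "i \<in> A" "j \<in> A" "f i = f j"
    thus "i = j" unfolding A_def by (cases i j rule: linorder_cases) force+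
  qed
  moreover have "f ` A = f ` {..n}"
  proof
    show "f ` {..n} \<subseteq> f ` A"
    proof
      fix x assume "x \<in> f ` {..n}"
      define I where "I = {i \<in> {..n}. f i = x}"
      have I: "finite I" "I \<noteq> {}" using \<open>x \<in> f ` {..n}\<close> by (auto simp: I_def)
      define t where "t = Max I"
      have "t \<in> I" unfolding t_def using I by (rule Max_in)
      hence t: "t \<le> n" "f t = x" by (auto simp: I_def)
      have "f j \<noteq> x" if "j \<in> {t<..n}" for j
      proof
        assume "f j = x"
        hence "j \<le> t" unfolding t_def using that I by (intro Max_ge) (auto simp: I_def)
        thus False using that by simp
      qed
      with t have "t \<in> A" by (auto simp: A_def)
      thus "x \<in> f ` A" using t by blast
    qed
  qed (auto simp: A_def)
  ultimately show ?thesis by (metis A_def card_image)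
qed

text \<open>Induction on \<open>n\<close>: the new position is adjacent to a point of the current
  interval, so it lies in the interval or extends it by one at an end.\<close>

lemma nearest_neighbour_image_eq_interval:
  fixes S :: "nat \<Rightarrow> int"
  assumes "\<And>n. \<bar>S (Suc n) - S n\<bar> = 1"
  shows "\<exists>a b. a \<le> b \<and> S ` {..n} = {a..b}"
proof (induction n)
  case 0
  show ?case by (intro exI[of _ "S 0"]) auto
next
  case (Suc n)
  then obtain a b where ab: "a \<le> b" "S ` {..n} = {a..b}" by blast
  have "S n \<in> {a..b}" using ab by blast
  hence "S (Suc n) \<in> {a - 1..b + 1}" using assms[of n] by auto
  hence "insert (S (Suc n)) {a..b} = {min a (S (Suc n))..max b (S (Suc n))}"
    using ab(1) by auto
  thus ?case using ab by (intro exI[of _ "min a (S (Suc n))"] exI[of _ "max b (S (Suc n))"])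
      (auto simp: atMost_Suc)
qed

text \<open>The range is an interval whose ends are \<open>S i\<close> and \<open>S j\<close> with
  \<open>i, j \<le> n\<close>. Since \<open>S i\<close> is close to \<open>i * v\<close>, its length
  is at most \<open>\<bar>j - i\<bar> * \<bar>v\<bar>\<close> up to an error, hence at most about
  \<open>n * \<bar>v\<bar>\<close>. Conversely it contains 0 and \<open>S n\<close>, so its length
  is at least \<open>\<bar>S n\<bar>\<close>.\<close>

lemma nearest_neighbour_range_growth:
  fixes S :: "nat \<Rightarrow> int"
  assumes S0: "S 0 = 0" and step: "\<And>n. \<bar>S (Suc n) - S n\<bar> = 1"
    and lim: "(\<lambda>n. real_of_int (S n) / real n) \<longlonglongrightarrow> v"
  shows "(\<lambda>n. real (card (S ` {..n})) / real n) \<longlonglongrightarrow> \<bar>v\<bar>"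
proof (rule LIMSEQ_I)
  fix r :: real assume "0 < r"
  \<comment> \<open>Two thirds of \<open>r\<close> pay for the term \<open>2 * e * n\<close> in
    \<open>bound\<close>, the last third for the constant \<open>2 * C + 1\<close>.\<close>
  define e where "e = r / 3"
  have e: "e > 0" using \<open>0 < r\<close> by (simp add: e_def)
  obtain N where N: "\<And>n. n \<ge> N \<Longrightarrow> \<bar>real_of_int (S n) / real n - v\<bar> < e"
    using LIMSEQ_D[OF lim e] by auto
  \<comment> \<open>\<open>C\<close> absorbs the times up to \<open>N\<close>, so that
    \<open>dev\<close> holds at every time: the extremes of the path may be attained early even when
    \<open>n\<close> is large.\<close>
  define C where "C = (\<Sum>i\<le>N. \<bar>real_of_int (S i) - real i * v\<bar>)"
  have C0: "C \<ge> 0" unfolding C_def by (intro sum_nonneg) auto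
  have dev: "\<bar>real_of_int (S i) - real i * v\<bar> \<le> C + e * real i" for i
  proof (cases "i \<le> N")
    case True
    hence "\<bar>real_of_int (S i) - real i * v\<bar> \<le> C"
      unfolding C_def by (intro member_le_sum) auto
    thus ?thesis using e by (smt (verit) mult_nonneg_nonneg of_nat_0_le_iff)
  next
    case False
    hence "i > 0" by auto
    moreover have "\<bar>real_of_int (S i) / real i - v\<bar> < e" using N False by auto
    moreover have "real_of_int (S i) - real i * v = (real_of_int (S i) / real i - v) * real i"
      using \<open>i > 0\<close> by (simp add: field_simps)
    ultimately have "\<bar>real_of_int (S i) - real i * v\<bar> \<le> e * real i"
      by (simp add: abs_mult)
    thus ?thesis using C0 by linarith
  qed
  have bound: "\<bar>real (card (S ` {..n})) - real n * \<bar>v\<bar>\<bar> \<le> 2 * C + 1 + 2 * e * real n" for n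
  proof -
    obtain a b where ab: "a \<le> b" "S ` {..n} = {a..b}"
      using nearest_neighbour_image_eq_interval[of S n] step by auto
    have "a \<in> S ` {..n}" "b \<in> S ` {..n}" "0 \<in> S ` {..n}" "S n \<in> S ` {..n}"
      using ab S0 by force+
    then obtain i j where ij: "a = S i" "i \<le> n" "b = S j" "j \<le> n"
      and in_ab: "a \<le> 0" "0 \<le> b" "a \<le> S n" "S n \<le> b"
      by (metis ab(2) atLeastAtMost_iff atMost_iff imageE)
    have card: "real (card (S ` {..n})) = real_of_int b - real_of_int a + 1"
      using ab by simp
    have "e * real i \<le> e * real n" "e * real j \<le> e * real n"
      using ij e by auto
    moreover have "(real j - real i) * v \<le> real n * \<bar>v\<bar>"
    proof -
      have "(real j - real i) * v \<le> \<bar>real j - real i\<bar> * \<bar>v\<bar>"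
        by (metis abs_ge_self abs_mult)
      also have "\<dots> \<le> real n * \<bar>v\<bar>" using ij by (intro mult_right_mono) auto
      finally show ?thesis .
    qed
    ultimately have "real (card (S ` {..n})) \<le> real n * \<bar>v\<bar> + 2 * C + 1 + 2 * e * real n"
      using dev[of i] dev[of j] unfolding card ij(1,3) by (simp add: algebra_simps)
    moreover have "real (card (S ` {..n})) \<ge> \<bar>real_of_int (S n)\<bar>"
      unfolding card using in_ab by linarith
    moreover have "\<bar>real_of_int (S n)\<bar> \<ge> real n * \<bar>v\<bar> - (C + e * real n)"
      using dev[of n] abs_mult[of "real n" v] by simp
    moreover have "e * real n \<ge> 0" using e by simp
    ultimately show ?thesis using C0 by linarith
  qed
  obtain K :: nat where K: "real K > (2 * C + 1) / e" using reals_Archimedean2 by blast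
  show "\<exists>no. \<forall>n\<ge>no. norm (real (card (S ` {..n})) / real n - \<bar>v\<bar>) < r"
  proof (intro exI[of _ K] allI impI)
    fix n assume "n \<ge> K"
    hence n: "real n > (2 * C + 1) / e" using K by linarith
    moreover have "(2 * C + 1) / e > 0" using C0 e by simp
    ultimately have "real n > 0" by linarith
    have "\<bar>real (card (S ` {..n})) - real n * \<bar>v\<bar>\<bar> < r * real n"
      using bound[of n] n e unfolding e_def by (simp add: field_simps)
    moreover have "real (card (S ` {..n})) / real n - \<bar>v\<bar>
        = (real (card (S ` {..n})) - real n * \<bar>v\<bar>) / real n"
      using \<open>real n > 0\<close> by (simp add: field_simps)
    ultimately show "norm (real (card (S ` {..n})) / real n - \<bar>v\<bar>) < r"
      using \<open>real n > 0\<close> by (simp add: abs_divide divide_less_eq)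
  qed
qed

section \<open>The walk as a function of its steps\<close>

lemma measurable_walk:
  assumes "\<And>i. 1 \<le> i \<Longrightarrow> X i \<in> N \<rightarrow>\<^sub>M count_space UNIV"
  shows "walk X n \<in> N \<rightarrow>\<^sub>M count_space UNIV"
proof (induction n)
  case 0
  have "walk X 0 = (\<lambda>_. 0)" by (auto simp: walk_def)
  thus ?case by simp
next
  case (Suc n)
  have "(\<lambda>\<omega>. walk X n \<omega> + X (Suc n) \<omega>) \<in> N \<rightarrow>\<^sub>M count_space UNIV"
  proof (rule measurable_compose_countable[OF _ Suc.IH])
    fix a :: int
    show "(\<lambda>\<omega>. a + X (Suc n) \<omega>) \<in> N \<rightarrow>\<^sub>M count_space UNIV"
      by (rule measurable_compose[OF assms]) auto
  qed
  moreover have "walk X (Suc n) = (\<lambda>\<omega>. walk X n \<omega> + X (Suc n) \<omega>)"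
    by (auto simp: walk_def)
  ultimately show ?case by simp
qed

text \<open>With the coordinate projections as steps, \<open>walk\<close> is the walk on the
  canonical space of step sequences. Events of the walk can thus be pulled back from that space,
  where laws are compared and where \<open>indep_scenery\<close> is formulated.\<close>

lemma measurable_walk_PiM [measurable]:
  "walk (\<lambda>i f. f i) n \<in> Pi\<^sub>M {1..} (\<lambda>_. count_space UNIV) \<rightarrow>\<^sub>M count_space UNIV"
  by (rule measurable_walk) (auto intro: measurable_component_singleton)

lemma walk_restrict: "walk (\<lambda>i f. f i) n (\<lambda>i\<in>{1..}. X i \<omega>) = walk X n \<omega>"
  unfolding walk_def by (intro sum.cong) auto

lemma walk_shift: "walk (\<lambda>i. X (i + a)) n \<omega> = walk X (n + a) \<omega> - walk X a \<omega>"
proof -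
  have "{1..n + a} = {1..a} \<union> {1 + a..n + a}" by auto
  hence "walk X (n + a) \<omega> = walk X a \<omega> + (\<Sum>i=1 + a..n + a. X i \<omega>)"
    unfolding walk_def by (simp add: sum.union_disjoint)
  also have "(\<Sum>i=1 + a..n + a. X i \<omega>) = walk (\<lambda>i. X (i + a)) n \<omega>"
    unfolding walk_def by (rule sum.shift_bounds_cl_nat_ivl)
  finally show ?thesis by simp
qed

section \<open>The random walk: shift invariance, strong law and growth of the range\<close>

locale nearest_neighbour_walk = prob_space M for M :: "'a measure" +
  fixes X :: "nat \<Rightarrow> 'a \<Rightarrow> int" and p :: real
  assumes indep_steps: "indep_vars (\<lambda>_. count_space UNIV) X {1..}"
    and prob_up: "1 \<le> i \<Longrightarrow> prob {\<omega> \<in> space M. X i \<omega> = 1} = p"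
    and prob_down: "1 \<le> i \<Longrightarrow> prob {\<omega> \<in> space M. X i \<omega> = - 1} = 1 - p"
begin

lemma measurable_step: "1 \<le> i \<Longrightarrow> X i \<in> M \<rightarrow>\<^sub>M count_space UNIV"
  using indep_steps unfolding indep_vars_def by auto

lemma measurable_walk' [measurable]: "walk X n \<in> M \<rightarrow>\<^sub>M count_space UNIV"
  by (intro measurable_walk measurable_step)

text \<open>The two prescribed probabilities add up to 1, so no other value carries mass.\<close>

lemma AE_step:
  assumes "1 \<le> i"
  shows "AE \<omega> in M. X i \<omega> = 1 \<or> X i \<omega> = - 1"
proof -
  note [measurable] = measurable_step[OF assms]
  have "prob {\<omega> \<in> space M. X i \<omega> = 1 \<or> X i \<omega> = - 1}
      = prob ({\<omega> \<in> space M. X i \<omega> = 1} \<union> {\<omega> \<in> space M. X i \<omega> = - 1})"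
    by (rule arg_cong[where f = prob]) auto
  also have "\<dots> = 1"
    using prob_up[OF assms] prob_down[OF assms]
    by (subst finite_measure_Union) auto
  finally show ?thesis by (subst (asm) prob_Collect_eq_1) auto
qed

lemma AE_walk_step: "AE \<omega> in M. \<forall>n. \<bar>walk X (Suc n) \<omega> - walk X n \<omega>\<bar> = 1"
proof -
  have "AE \<omega> in M. \<forall>n. X (Suc n) \<omega> = 1 \<or> X (Suc n) \<omega> = - 1"
    unfolding AE_all_countable using AE_step by simp
  thus ?thesis by eventually_elim (simp add: walk_def, smt (verit))
qed

lemma distr_step:
  assumes "1 \<le> i"
  shows "distr M (count_space UNIV) (X i) = distr M (count_space UNIV) (X 1)"
proof (rule measure_eqI_countable_AE[where \<Omega> = "{1, - 1}"])
  note [measurable] = measurable_step[OF assms] measurable_step[of 1, simplified]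
  show "AE x in distr M (count_space UNIV) (X i). x \<in> {1, - 1}"
    using AE_step[OF assms] by (subst AE_distr_iff) auto
  show "AE x in distr M (count_space UNIV) (X 1). x \<in> {1, - 1}"
    using AE_step[of 1] by (subst AE_distr_iff) auto
  have vim: "X j -` {x} \<inter> space M = {\<omega> \<in> space M. X j \<omega> = x}" for j x by auto
  fix x :: int assume "x \<in> {1, - 1}"
  thus "emeasure (distr M (count_space UNIV) (X i)) {x}
      = emeasure (distr M (count_space UNIV) (X 1)) {x}"
    using prob_up[OF assms] prob_down[OF assms] prob_up[of 1] prob_down[of 1]
    by (auto simp: emeasure_distr vim emeasure_eq_measure)
qed auto

text \<open>By independence and \<open>distr_step\<close> the steps have as joint law a product of
  copies of one measure, and such a product is invariant under reindexing along the injective map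
  that sends \<open>i\<close> to \<open>i + a\<close>.\<close>

lemma distr_shift_steps:
  "distr M (Pi\<^sub>M {1..} (\<lambda>_. count_space UNIV)) (\<lambda>\<omega>. \<lambda>i\<in>{1..}. X (i + a) \<omega>)
   = distr M (Pi\<^sub>M {1..} (\<lambda>_. count_space UNIV)) (\<lambda>\<omega>. \<lambda>i\<in>{1..}. X i \<omega>)"
proof -
  define P :: "(nat \<Rightarrow> int) measure" where "P = Pi\<^sub>M {1..} (\<lambda>_. count_space UNIV)"
  define D where "D = distr M (count_space UNIV) (X 1)"
  note [measurable] = measurable_step
  interpret D: prob_space D unfolding D_def by (intro prob_space_distr) simp
  have setsD: "sets D = sets (count_space UNIV)" by (simp add: D_def)
  have sets_eq: "sets (Pi\<^sub>M {1..} (\<lambda>_. D)) = sets P"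
    unfolding P_def by (rule sets_PiM_cong) (auto simp: setsD)
  have "distr M P (\<lambda>\<omega>. \<lambda>i\<in>{1..}. X i \<omega>) = Pi\<^sub>M {1..} (\<lambda>i. distr M (count_space UNIV) (X i))"
    unfolding P_def
    by (rule indep_vars_iff_distr_eq_PiM'[THEN iffD1, OF _ _ indep_steps])
       (auto intro: measurable_step)
  also have "\<dots> = Pi\<^sub>M {1..} (\<lambda>_. D)"
    unfolding D_def by (intro PiM_cong refl distr_step) simp
  finally have law: "distr M P (\<lambda>\<omega>. \<lambda>i\<in>{1..}. X i \<omega>) = Pi\<^sub>M {1..} (\<lambda>_. D)" .
  have X_meas: "(\<lambda>\<omega>. \<lambda>i\<in>{1..}. X i \<omega>) \<in> M \<rightarrow>\<^sub>M P"
    unfolding P_def by (intro measurable_restrict) auto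
  have shift_meas: "(\<lambda>f. \<lambda>i\<in>{1..}. f (i + a)) \<in> P \<rightarrow>\<^sub>M P"
    unfolding P_def by (intro measurable_restrict measurable_component_singleton) auto
  have "Pi\<^sub>M {1..} (\<lambda>_. D) = distr (Pi\<^sub>M {1..} (\<lambda>_. D)) (Pi\<^sub>M {1..} (\<lambda>_. D)) (\<lambda>f. \<lambda>i\<in>{1..}. f (i + a))"
    by (intro distr_PiM_reindex[symmetric]) (auto simp: D.prob_space_axioms)
  also have "\<dots> = distr (distr M P (\<lambda>\<omega>. \<lambda>i\<in>{1..}. X i \<omega>)) P (\<lambda>f. \<lambda>i\<in>{1..}. f (i + a))"
    unfolding law by (intro distr_cong refl sets_eq)
  also have "\<dots> = distr M P (\<lambda>\<omega>. \<lambda>i\<in>{1..}. X (i + a) \<omega>)"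
    by (subst distr_distr[OF shift_meas X_meas]) (auto intro!: distr_cong simp: o_def)
  finally show ?thesis unfolding law[symmetric] P_def by simp
qed

text \<open>Seen from its position at time \<open>a\<close>, the later walk is driven by the shifted
  steps, which have the same joint law as the original ones.\<close>

lemma prob_no_return_shift:
  "prob {\<omega> \<in> space M. \<forall>j\<in>{a<..a + m}. walk X j \<omega> \<noteq> walk X a \<omega>}
   = prob {\<omega> \<in> space M. \<forall>j\<in>{1..m}. walk X j \<omega> \<noteq> 0}"
proof -
  define P :: "(nat \<Rightarrow> int) measure" where "P = Pi\<^sub>M {1..} (\<lambda>_. count_space UNIV)"
  have meas: "(\<lambda>\<omega>. \<lambda>i\<in>{1..}. X (i + b) \<omega>) \<in> M \<rightarrow>\<^sub>M P" for b
    unfolding P_def by (intro measurable_restrict measurable_step) auto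
  define A where "A = {f \<in> space P. \<forall>j\<in>{1..m}. walk (\<lambda>i f. f i) j f \<noteq> 0}"
  have A: "A \<in> sets P" unfolding A_def P_def by measurable
  \<comment> \<open>The shift \<open>b\<close> is arbitrary so that the cases \<open>b = a\<close>
    and \<open>b = 0\<close> can be compared below.\<close>
  have eq: "prob {\<omega> \<in> space M. \<forall>j\<in>{1..m}. walk (\<lambda>i. X (i + b)) j \<omega> \<noteq> 0}
      = measure (distr M P (\<lambda>\<omega>. \<lambda>i\<in>{1..}. X (i + b) \<omega>)) A" for b
    unfolding measure_distr[OF meas A]
    using measurable_space[OF meas[of b]]
    by (intro arg_cong[where f = prob])
       (auto simp: A_def walk_restrict[where X = "\<lambda>i. X (i + b)", simplified])
  have "(\<forall>j\<in>{a<..a + m}. walk X j \<omega> \<noteq> walk X a \<omega>)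
      \<longleftrightarrow> (\<forall>j\<in>{1..m}. walk (\<lambda>i. X (i + a)) j \<omega> \<noteq> 0)" for \<omega>
  proof -
    have shift: "j \<in> {a<..a + m} \<longleftrightarrow> (\<exists>i\<in>{1..m}. j = i + a)" for j
      by (auto simp: Bex_def intro!: exI[of _ "j - a"])
    have "(\<forall>j\<in>{a<..a + m}. P j) \<longleftrightarrow> (\<forall>i\<in>{1..m}. P (i + a))" for P
      unfolding Ball_def[of "{a<..a + m}"] shift by blast
    thus ?thesis by (simp add: walk_shift)
  qed
  hence "prob {\<omega> \<in> space M. \<forall>j\<in>{a<..a + m}. walk X j \<omega> \<noteq> walk X a \<omega>}
      = prob {\<omega> \<in> space M. \<forall>j\<in>{1..m}. walk (\<lambda>i. X (i + a)) j \<omega> \<noteq> 0}"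
    by simp
  also have "\<dots> = prob {\<omega> \<in> space M. \<forall>j\<in>{1..m}. walk (\<lambda>i. X (i + 0)) j \<omega> \<noteq> 0}"
    unfolding eq using distr_shift_steps[of a] by (simp add: P_def)
  finally show ?thesis by simp
qed

text \<open>The range is counted by its last visits. A last visit at time \<open>i\<close> means no
  return during the remaining \<open>m = n - i\<close> steps, and the sum is reindexed by
  \<open>m\<close>.\<close>

lemma expectation_card_range:
  "expectation (\<lambda>\<omega>. real (card ((\<lambda>i. walk X i \<omega>) ` {..n})))
   = (\<Sum>m<Suc n. prob {\<omega> \<in> space M. \<forall>j\<in>{1..m}. walk X j \<omega> \<noteq> 0})"
proof -
  let ?E = "\<lambda>i. {\<omega> \<in> space M. \<forall>j\<in>{i<..n}. walk X j \<omega> \<noteq> walk X i \<omega>}"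
  have E [measurable]: "?E i \<in> sets M" for i by measurable
  have "expectation (\<lambda>\<omega>. real (card ((\<lambda>i. walk X i \<omega>) ` {..n})))
      = expectation (\<lambda>\<omega>. \<Sum>i\<le>n. indicator (?E i) \<omega>)"
  proof (intro Bochner_Integration.integral_cong refl)
    fix \<omega> assume "\<omega> \<in> space M"
    have "(\<Sum>i\<le>n. indicator (?E i) \<omega>) = (\<Sum>i\<le>n. if \<forall>j\<in>{i<..n}. walk X j \<omega> \<noteq> walk X i \<omega> then 1 else 0 :: real)"
      using \<open>\<omega> \<in> space M\<close> by (intro sum.cong) (auto simp: indicator_def)
    also have "\<dots> = real (card {i \<in> {..n}. \<forall>j\<in>{i<..n}. walk X j \<omega> \<noteq> walk X i \<omega>})"
      by (simp add: sum.If_cases Int_def)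
    finally show "real (card ((\<lambda>i. walk X i \<omega>) ` {..n})) = (\<Sum>i\<le>n. indicator (?E i) \<omega>)"
      by (simp add: card_image_eq_card_last_visits)
  qed
  also have "\<dots> = (\<Sum>i\<le>n. prob (?E i))"
    by (subst Bochner_Integration.integral_sum) (auto simp: emeasure_eq_measure)
  also have "\<dots> = (\<Sum>i\<le>n. prob {\<omega> \<in> space M. \<forall>j\<in>{1..n - i}. walk X j \<omega> \<noteq> 0})"
  proof (intro sum.cong refl)
    fix i assume "i \<in> {..n}"
    thus "prob (?E i) = prob {\<omega> \<in> space M. \<forall>j\<in>{1..n - i}. walk X j \<omega> \<noteq> 0}"
      using prob_no_return_shift[of i "n - i"] by simp
  qed
  also have "\<dots> = (\<Sum>m\<le>n. prob {\<omega> \<in> space M. \<forall>j\<in>{1..m}. walk X j \<omega> \<noteq> 0})"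
    using sum.nat_diff_reindex[of "\<lambda>m. prob {\<omega> \<in> space M. \<forall>j\<in>{1..m}. walk X j \<omega> \<noteq> 0}" "Suc n"]
    by (simp add: lessThan_Suc_atMost)
  finally show ?thesis by (simp only: lessThan_Suc_atMost)
qed

text \<open>The steps are bounded, so Hoeffding's inequality gives geometrically small deviation
  probabilities; these are summable, and the first Borel-Cantelli lemma applies.\<close>

lemma walk_strong_law: "AE \<omega> in M. (\<lambda>n. real_of_int (walk X n \<omega>) / real n) \<longlonglongrightarrow> 2 * p - 1"
proof -
  note [measurable] = measurable_step
  have mean: "expectation (\<lambda>\<omega>. real_of_int (X i \<omega>)) = 2 * p - 1" if "1 \<le> i" for i
  proof -
    note [measurable] = measurable_step[OF that]
    \<comment> \<open>On the values 1 and -1 a step is twice the indicator of an upward step, minus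
      one.\<close>
    have "expectation (\<lambda>\<omega>. real_of_int (X i \<omega>))
        = expectation (\<lambda>\<omega>. 2 * indicator {\<omega> \<in> space M. X i \<omega> = 1} \<omega> - 1)"
      using AE_step[OF that] by (intro integral_cong_AE) (auto simp: indicator_def)
    also have "\<dots> = 2 * p - 1"
      using prob_up[OF that] by (subst Bochner_Integration.integral_diff)
        (auto simp: emeasure_eq_measure prob_space)
    finally show ?thesis .
  qed
  have deviation: "prob {\<omega> \<in> space M. \<bar>real_of_int (walk X n \<omega>) - real n * (2 * p - 1)\<bar> \<ge> e * real n}
      \<le> 2 * exp (- e\<^sup>2 / 2) ^ n" if "e > 0" for e n
  proof (cases "n = 0")
    \<comment> \<open>At \<open>n = 0\<close> the sum of squared widths, by which Hoeffding's
      exponent divides, is zero; the claimed bound is then 2.\<close>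
    case True
    have "prob A \<le> 2" for A using prob_le_1[of A] by linarith
    thus ?thesis using True by simp
  next
    case False
    interpret Hoeffding_ineq M "{1..n}" "\<lambda>i \<omega>. real_of_int (X i \<omega>)" "\<lambda>_. - 1" "\<lambda>_. 1"
      "\<Sum>i\<in>{1..n}. expectation (\<lambda>\<omega>. real_of_int (X i \<omega>))"
    proof unfold_locales
      show "indep_vars (\<lambda>_. borel) (\<lambda>i \<omega>. real_of_int (X i \<omega>)) {1..n}"
        by (rule indep_vars_compose2[OF indep_vars_subset[OF indep_steps]]) auto
      show "AE \<omega> in M. real_of_int (X i \<omega>) \<in> {- 1..1}" if "i \<in> {1..n}" for i
        using AE_step[of i] that by auto
    qed auto
    have "prob {\<omega> \<in> space M. \<bar>real_of_int (walk X n \<omega>) - real n * (2 * p - 1)\<bar> \<ge> e * real n}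
        \<le> 2 * exp (- 2 * (e * real n)\<^sup>2 / (\<Sum>i\<in>{1..n}. (1 - - 1)\<^sup>2))"
      using Hoeffding_ineq_abs_ge[of "e * real n"] False \<open>e > 0\<close> by (simp add: mean walk_def)
    \<comment> \<open>Each of the \<open>n\<close> squared widths equals 4.\<close>
    also have "- 2 * (e * real n)\<^sup>2 / (\<Sum>i\<in>{1..n}. (1 - - 1)\<^sup>2) = real n * (- e\<^sup>2 / 2)"
      using False by (simp add: field_simps power2_eq_square)
    finally show ?thesis by (simp only: exp_of_nat_mult)
  qed
  \<comment> \<open>Only the accuracies \<open>1 / (k + 1)\<close> are treated, so that countably
    many null sets suffice for all accuracies at once.\<close>
  have "AE \<omega> in M. \<forall>\<^sub>F n in sequentially.
      \<bar>real_of_int (walk X n \<omega>) - real n * (2 * p - 1)\<bar> < inverse (real (Suc k)) * real n" for k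
  proof -
    let ?A = "\<lambda>n. {\<omega> \<in> space M.
      \<bar>real_of_int (walk X n \<omega>) - real n * (2 * p - 1)\<bar> \<ge> inverse (real (Suc k)) * real n}"
    have "AE \<omega> in M. \<forall>\<^sub>F n in sequentially. \<omega> \<in> space M - ?A n"
    proof (rule borel_cantelli_AE1)
      have "exp (- (inverse (real (Suc k)))\<^sup>2 / 2) < 1" by simp
      thus "summable (\<lambda>n. prob (?A n))"
        using deviation[of "inverse (real (Suc k))"]
        by (intro summable_comparison_test'[OF summable_mult[OF summable_geometric]]) auto
    qed (auto simp: less_top[symmetric])
    thus ?thesis
      by eventually_elim (auto elim!: eventually_mono simp: not_le)
  qed
  hence "AE \<omega> in M. \<forall>k. \<forall>\<^sub>F n in sequentially.
      \<bar>real_of_int (walk X n \<omega>) - real n * (2 * p - 1)\<bar> < inverse (real (Suc k)) * real n"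
    by (simp add: AE_all_countable)
  thus ?thesis
  proof eventually_elim
    case (elim \<omega>)
    show ?case
    proof (rule tendstoI)
      fix e :: real assume "e > 0"
      then obtain k where k: "inverse (real (Suc k)) < e" using reals_Archimedean by blast
      show "\<forall>\<^sub>F n in sequentially. dist (real_of_int (walk X n \<omega>) / real n) (2 * p - 1) < e"
        using elim[rule_format, of k] eventually_gt_at_top[of 0]
      proof eventually_elim
        case (elim n)
        have "\<bar>real_of_int (walk X n \<omega>) - real n * (2 * p - 1)\<bar> < e * real n"
          using elim k by (meson mult_strict_right_mono of_nat_0_less_iff order_less_trans)
        moreover have "real_of_int (walk X n \<omega>) / real n - (2 * p - 1)
            = (real_of_int (walk X n \<omega>) - real n * (2 * p - 1)) / real n"
          using elim(2) by (simp add: field_simps)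
        ultimately show ?case
          using elim(2) by (simp add: dist_real_def abs_divide divide_less_eq)
      qed
    qed
  qed
qed

lemma AE_range_growth:
  "AE \<omega> in M. (\<lambda>n. real (card ((\<lambda>i. walk X i \<omega>) ` {..n})) / real n) \<longlonglongrightarrow> \<bar>2 * p - 1\<bar>"
  using walk_strong_law AE_walk_step
proof eventually_elim
  case (elim \<omega>)
  show ?case
    by (rule nearest_neighbour_range_growth[where S = "\<lambda>n. walk X n \<omega>"])
       (use elim in \<open>auto simp: walk_def\<close>)
qed

text \<open>Counting last visits replaces the cardinality of a random image by a count of measurable
  conditions over the fixed set \<open>{..n}\<close>.\<close>

lemma measurable_card_range [measurable]:
  "(\<lambda>\<omega>. card ((\<lambda>i. walk X i \<omega>) ` {..n})) \<in> M \<rightarrow>\<^sub>M count_space UNIV"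
  unfolding card_image_eq_card_last_visits by measurable

text \<open>The limit of the expected range divided by \<open>n + 1\<close> is computed twice: as a
  Cesaro mean of the no-return probabilities, which decrease to the left-hand side, and by dominated
  convergence from \<open>AE_range_growth\<close>. Dividing by \<open>n + 1\<close>, the number of
  times involved, keeps the ratio at most 1 for every \<open>n\<close>.\<close>

lemma prob_no_return: "prob {\<omega> \<in> space M. \<forall>i\<ge>1. walk X i \<omega> \<noteq> 0} = \<bar>2 * p - 1\<bar>"
proof -
  define A where "A m = {\<omega> \<in> space M. \<forall>j\<in>{1..m}. walk X j \<omega> \<noteq> 0}" for m
  have "(\<lambda>m. prob (A m)) \<longlonglongrightarrow> prob (\<Inter>m. A m)"
  proof (rule finite_Lim_measure_decseq)
    have "A m \<in> events" for m unfolding A_def by measurable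
    thus "range A \<subseteq> events" by blast
    show "decseq A" unfolding A_def decseq_def by auto
  qed
  also have "(\<Inter>m. A m) = {\<omega> \<in> space M. \<forall>i\<ge>1. walk X i \<omega> \<noteq> 0}"
    unfolding A_def by auto (metis One_nat_def atLeastAtMost_iff order_refl)
  finally have "(\<lambda>n. (\<Sum>m<Suc n. prob (A m)) / real (Suc n))
      \<longlonglongrightarrow> prob {\<omega> \<in> space M. \<forall>i\<ge>1. walk X i \<omega> \<noteq> 0}"
    by (intro LIMSEQ_Suc LIMSEQ_Cesaro_mean)
  moreover have "(\<lambda>n. expectation (\<lambda>\<omega>. real (card ((\<lambda>i. walk X i \<omega>) ` {..n})) / real (Suc n)))
      \<longlonglongrightarrow> expectation (\<lambda>_. \<bar>2 * p - 1\<bar>)"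
  proof (rule integral_dominated_convergence[where w = "\<lambda>_. 1"])
    have ratio: "(\<lambda>n. real n / real (Suc n)) \<longlonglongrightarrow> 1" by (rule LIMSEQ_n_over_Suc_n)
    show "AE \<omega> in M. (\<lambda>n. real (card ((\<lambda>i. walk X i \<omega>) ` {..n})) / real (Suc n)) \<longlonglongrightarrow> \<bar>2 * p - 1\<bar>"
      using AE_range_growth
    proof eventually_elim
      case (elim \<omega>)
      show ?case
        by (rule Lim_transform_eventually[OF tendsto_mult[OF elim ratio, simplified]])
           (use eventually_gt_at_top[of 0] in eventually_elim, simp)
    qed
    show "AE \<omega> in M. norm (real (card ((\<lambda>i. walk X i \<omega>) ` {..n})) / real (Suc n)) \<le> 1" for n
    proof (rule AE_I2)
      fix \<omega>
      have "card ((\<lambda>i. walk X i \<omega>) ` {..n}) \<le> Suc n"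
        using card_image_le[of "{..n}" "\<lambda>i. walk X i \<omega>"] by simp
      thus "norm (real (card ((\<lambda>i. walk X i \<omega>) ` {..n})) / real (Suc n)) \<le> 1"
        by simp
    qed
  qed auto
  ultimately show ?thesis
    using LIMSEQ_unique by (simp add: expectation_card_range A_def prob_space)
qed

end

section \<open>The stationary scenery: shifts of blocks and change of threshold\<close>

text \<open>For times and integer sites the quantifiers on the right run over countable sets, which
  makes the event that the range equals \<open>T\<close> visibly measurable.\<close>

lemma image_eq_iff: "f ` A = T \<longleftrightarrow> (\<forall>i\<in>A. f i \<in> T) \<and> (\<forall>t\<in>T. \<exists>i\<in>A. f i = t)"
  unfolding set_eq_subset image_subset_iff subset_iff[of T] image_iff by metis

locale stationary_scenery = prob_space M for M :: "'a measure" +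
  fixes \<xi> :: "int \<Rightarrow> 'a \<Rightarrow> real"
  assumes stationary: "stationary M \<xi>"
begin

lemma measurable_scenery [measurable]: "\<xi> s \<in> borel_measurable M"
  using stationary unfolding stationary_def by blast

lemma measurable_scenery_path: "(\<lambda>\<omega> s. \<xi> (s + h) \<omega>) \<in> M \<rightarrow>\<^sub>M Pi\<^sub>M UNIV (\<lambda>_. borel)"
  by (rule measurable_PiM_single') (auto simp: space_PiM)

lemma sets_all_le: "{f \<in> space (Pi\<^sub>M UNIV (\<lambda>_. borel)). \<forall>s\<in>T. f s \<le> (x :: real)}
    \<in> sets (Pi\<^sub>M (UNIV :: int set) (\<lambda>_. borel))"
  by measurable

lemma prob_all_le_shift:
  "prob {\<omega> \<in> space M. \<forall>s\<in>{a + h..b + h}. \<xi> s \<omega> \<le> x} = prob {\<omega> \<in> space M. \<forall>s\<in>{a..b}. \<xi> s \<omega> \<le> x}"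
proof -
  define P :: "(int \<Rightarrow> real) measure" where "P = Pi\<^sub>M UNIV (\<lambda>_. borel)"
  define A where "A = {f \<in> space P. \<forall>s\<in>{a..b}. f s \<le> x}"
  have A: "A \<in> sets P" unfolding A_def P_def by (rule sets_all_le)
  have eq: "prob {\<omega> \<in> space M. \<forall>s\<in>{a..b}. \<xi> (s + k) \<omega> \<le> x}
      = measure (distr M P (\<lambda>\<omega> s. \<xi> (s + k) \<omega>)) A" for k
    unfolding measure_distr[OF measurable_scenery_path[folded P_def] A]
    by (intro arg_cong[where f = prob]) (auto simp: A_def P_def space_PiM)
  have shift: "j \<in> {a + h..b + h} \<longleftrightarrow> (\<exists>i\<in>{a..b}. j = i + h)" for j
    by (auto simp: Bex_def intro!: exI[of _ "j - h"])
  have "(\<forall>s\<in>{a + h..b + h}. \<xi> s \<omega> \<le> x) \<longleftrightarrow> (\<forall>s\<in>{a..b}. \<xi> (s + h) \<omega> \<le> x)" for \<omega>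
    unfolding Ball_def[of "{a + h..b + h}"] shift by blast
  hence "prob {\<omega> \<in> space M. \<forall>s\<in>{a + h..b + h}. \<xi> s \<omega> \<le> x}
      = prob {\<omega> \<in> space M. \<forall>s\<in>{a..b}. \<xi> (s + h) \<omega> \<le> x}"
    by simp
  also have "\<dots> = prob {\<omega> \<in> space M. \<forall>s\<in>{a..b}. \<xi> (s + 0) \<omega> \<le> x}"
    unfolding eq using stationary unfolding stationary_def P_def by simp
  finally show ?thesis by simp
qed

lemma prob_gt_eq: "prob {\<omega> \<in> space M. \<xi> s \<omega> > x} = prob {\<omega> \<in> space M. \<xi> 0 \<omega> > x}"
proof -
  have "prob {\<omega> \<in> space M. \<xi> s \<omega> > x} = 1 - prob {\<omega> \<in> space M. \<xi> s \<omega> \<le> x}" for s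
    by (subst prob_neg[symmetric]) (auto simp: not_le)
  moreover have "prob {\<omega> \<in> space M. \<xi> s \<omega> \<le> x} = prob {\<omega> \<in> space M. \<xi> 0 \<omega> \<le> x}"
    using prob_all_le_shift[of 0 s 0 x] by simp
  ultimately show ?thesis by simp
qed

text \<open>For \<open>x \<le> y\<close> the two events differ only if some \<open>\<xi> s\<close>
  lies in the gap between the thresholds. A union bound over the \<open>m + 1\<close> sites, equally
  likely by stationarity, gives the estimate.\<close>

lemma prob_all_le_threshold_diff:
  "\<bar>prob {\<omega> \<in> space M. \<forall>s\<in>{0..int m}. \<xi> s \<omega> \<le> x} - prob {\<omega> \<in> space M. \<forall>s\<in>{0..int m}. \<xi> s \<omega> \<le> y}\<bar>
   \<le> real (Suc m) * \<bar>prob {\<omega> \<in> space M. \<xi> 0 \<omega> > x} - prob {\<omega> \<in> space M. \<xi> 0 \<omega> > y}\<bar>"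
proof (induction x y rule: linorder_wlog)
  case (le x y)
  let ?F = "\<lambda>z. {\<omega> \<in> space M. \<forall>s\<in>{0..int m}. \<xi> s \<omega> \<le> z}"
  \<comment> \<open>This is the event \<open>x < \<xi> s \<le> y\<close>, written as a difference so
    that its probability is a difference of exceedance probabilities.\<close>
  let ?B = "\<lambda>s. {\<omega> \<in> space M. \<xi> s \<omega> > x} - {\<omega> \<in> space M. \<xi> s \<omega> > y}"
  have sub: "?F x \<subseteq> ?F y" using le by force
  have "prob (?F y) - prob (?F x) = prob (?F y - ?F x)"
    by (rule finite_measure_Diff[symmetric]) (use sub in auto)
  also have "\<dots> \<le> prob (\<Union>s\<in>{0..int m}. ?B s)"
    by (intro finite_measure_mono) (auto simp: not_le not_less)
  also have "\<dots> \<le> (\<Sum>s\<in>{0..int m}. prob (?B s))"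
    by (intro finite_measure_subadditive_finite) auto
  also have "\<dots> = (\<Sum>s\<in>{0..int m}. prob {\<omega> \<in> space M. \<xi> 0 \<omega> > x} - prob {\<omega> \<in> space M. \<xi> 0 \<omega> > y})"
  proof (intro sum.cong refl)
    fix s
    have "prob (?B s) = prob {\<omega> \<in> space M. \<xi> s \<omega> > x} - prob {\<omega> \<in> space M. \<xi> s \<omega> > y}"
      by (rule finite_measure_Diff) (use le in auto)
    thus "prob (?B s) = prob {\<omega> \<in> space M. \<xi> 0 \<omega> > x} - prob {\<omega> \<in> space M. \<xi> 0 \<omega> > y}"
      by (simp only: prob_gt_eq[of _ s])
  qed
  also have "\<dots> = real (Suc m) * (prob {\<omega> \<in> space M. \<xi> 0 \<omega> > x} - prob {\<omega> \<in> space M. \<xi> 0 \<omega> > y})"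
    by (simp add: nat_add_distrib)
  also have "\<dots> \<le> real (Suc m) * \<bar>prob {\<omega> \<in> space M. \<xi> 0 \<omega> > x} - prob {\<omega> \<in> space M. \<xi> 0 \<omega> > y}\<bar>"
    by (intro mult_left_mono) auto
  finally have "prob (?F y) - prob (?F x) \<le> \<dots>" .
  moreover have "prob (?F x) \<le> prob (?F y)"
    by (rule finite_measure_mono[OF sub]) measurable
  ultimately show ?case by simp
next
  case (sym x y)
  thus ?case by (simp only: abs_minus_commute)
qed

text \<open>On a block of length about \<open>m n\<close>, the thresholds \<open>u \<tau> n\<close>
  and \<open>u (c * \<tau>) (m n)\<close> have the same limiting mean number of exceedances,
  \<open>c * \<tau>\<close>. Hence one may replace the other, and the extremal assumption at level
  \<open>c * \<tau>\<close> is used along \<open>m n\<close>.\<close>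

lemma prob_all_le_rescaled:
  fixes u :: "real \<Rightarrow> nat \<Rightarrow> real" and m :: "nat \<Rightarrow> nat"
  assumes exceed: "\<And>\<tau>. \<tau> > 0 \<Longrightarrow> (\<lambda>n. real n * prob {\<omega> \<in> space M. \<xi> 0 \<omega> > u \<tau> n}) \<longlonglongrightarrow> \<tau>"
    and extremal: "\<And>\<tau>. \<tau> > 0 \<Longrightarrow>
      (\<lambda>n. prob {\<omega> \<in> space M. \<forall>s\<in>{0..int n}. \<xi> s \<omega> \<le> u \<tau> n}) \<longlonglongrightarrow> exp (- \<sigma> * \<tau>)"
    and m: "(\<lambda>n. real (m n) / real n) \<longlonglongrightarrow> c" and "c > 0" "\<tau> > 0"
  shows "(\<lambda>n. prob {\<omega> \<in> space M. \<forall>s\<in>{0..int (m n)}. \<xi> s \<omega> \<le> u \<tau> n}) \<longlonglongrightarrow> exp (- \<sigma> * c * \<tau>)"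
proof -
  have "c * \<tau> > 0" using \<open>c > 0\<close> \<open>\<tau> > 0\<close> by simp
  \<comment> \<open>As \<open>c > 0\<close>, eventually \<open>m n\<close> is at least
    \<open>c * n / 2\<close>.\<close>
  have m_lim: "filterlim (\<lambda>n. real (m n)) at_top sequentially"
  proof (rule filterlim_at_top_mono)
    have "filterlim (\<lambda>n. (c / 2) * real n) at_top sequentially"
      using \<open>c > 0\<close> by (intro filterlim_tendsto_pos_mult_at_top[OF tendsto_const _ filterlim_real_sequentially]) auto
    thus "filterlim (\<lambda>n. (c / 2) * real n) at_top sequentially" .
    have "\<forall>\<^sub>F n in sequentially. c / 2 < real (m n) / real n"
      using \<open>c > 0\<close> by (intro order_tendstoD(1)[OF m]) auto
    thus "\<forall>\<^sub>F n in sequentially. (c / 2) * real n \<le> real (m n)"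
      using eventually_gt_at_top[of 0] by eventually_elim (auto simp: field_simps)
  qed
  hence m_top: "filterlim m at_top sequentially"
    by (simp add: filterlim_sequentially_iff_filterlim_real)
  have mean_u: "(\<lambda>n. real (m n) * prob {\<omega> \<in> space M. \<xi> 0 \<omega> > u \<tau> n}) \<longlonglongrightarrow> c * \<tau>"
    by (rule Lim_transform_eventually[OF tendsto_mult[OF m exceed[OF \<open>\<tau> > 0\<close>]]])
       (use eventually_gt_at_top[of 0] in eventually_elim, simp)
  have mean_v: "(\<lambda>n. real (m n) * prob {\<omega> \<in> space M. \<xi> 0 \<omega> > u (c * \<tau>) (m n)}) \<longlonglongrightarrow> c * \<tau>"
    using filterlim_compose[OF exceed[OF \<open>c * \<tau> > 0\<close>] m_top] .
  define d where "d n = prob {\<omega> \<in> space M. \<xi> 0 \<omega> > u \<tau> n}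
    - prob {\<omega> \<in> space M. \<xi> 0 \<omega> > u (c * \<tau>) (m n)}" for n
  have md: "(\<lambda>n. real (m n) * d n) \<longlonglongrightarrow> 0"
    using tendsto_diff[OF mean_u mean_v] by (simp add: d_def right_diff_distrib)
  have "(\<lambda>n. 2 * \<bar>real (m n) * d n\<bar>) \<longlonglongrightarrow> 0"
    using tendsto_mult[OF tendsto_const tendsto_rabs[OF md], of 2] by simp
  moreover have "\<forall>\<^sub>F n in sequentially. norm (prob {\<omega> \<in> space M. \<forall>s\<in>{0..int (m n)}. \<xi> s \<omega> \<le> u \<tau> n}
      - prob {\<omega> \<in> space M. \<forall>s\<in>{0..int (m n)}. \<xi> s \<omega> \<le> u (c * \<tau>) (m n)}) \<le> 2 * \<bar>real (m n) * d n\<bar>"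
    \<comment> \<open>Once \<open>m n \<ge> 1\<close>, the number of sites \<open>m n + 1\<close> is
      at most \<open>2 * m n\<close>; hence the factor 2.\<close>
    using filterlim_at_top[THEN iffD1, rule_format, OF m_top, of 1]
  proof eventually_elim
    case (elim n)
    have "real (Suc (m n)) * \<bar>d n\<bar> \<le> (2 * real (m n)) * \<bar>d n\<bar>"
      using elim by (intro mult_right_mono) auto
    thus ?case
      using prob_all_le_threshold_diff[of "m n" "u \<tau> n" "u (c * \<tau>) (m n)"]
      unfolding d_def[symmetric] by (simp add: abs_mult mult.assoc)
  qed
  ultimately have "(\<lambda>n. prob {\<omega> \<in> space M. \<forall>s\<in>{0..int (m n)}. \<xi> s \<omega> \<le> u \<tau> n}
      - prob {\<omega> \<in> space M. \<forall>s\<in>{0..int (m n)}. \<xi> s \<omega> \<le> u (c * \<tau>) (m n)}) \<longlonglongrightarrow> 0"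
    by (rule Lim_null_comparison[rotated])
  from tendsto_add[OF this filterlim_compose[OF extremal[OF \<open>c * \<tau> > 0\<close>] m_top]]
  show ?thesis by (simp add: mult.assoc)
qed

end

section \<open>The scenery along the walk: conditioning on the range\<close>

locale walk_in_scenery = nearest_neighbour_walk M X p + stationary_scenery M \<xi>
  for M :: "'a measure" and X :: "nat \<Rightarrow> 'a \<Rightarrow> int" and p :: real and \<xi> :: "int \<Rightarrow> 'a \<Rightarrow> real" +
  assumes indep: "indep_scenery M \<xi> X"
begin

lemma measurable_scenery_walk [measurable]: "(\<lambda>\<omega>. \<xi> (walk X i \<omega>) \<omega>) \<in> borel_measurable M"
  by (rule measurable_compose_countable) measurable

text \<open>The first event is a pullback from the space of step sequences, the second from the
  space of sceneries, and \<open>indep_scenery\<close> makes these two \<sigma>-fields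
  independent.\<close>

lemma prob_range_Int_scenery:
  "prob ({\<omega> \<in> space M. (\<lambda>i. walk X i \<omega>) ` {..n} = T} \<inter> {\<omega> \<in> space M. \<forall>s\<in>T. \<xi> s \<omega> \<le> x})
   = prob {\<omega> \<in> space M. \<forall>s\<in>T. \<xi> s \<omega> \<le> x} * prob {\<omega> \<in> space M. (\<lambda>i. walk X i \<omega>) ` {..n} = T}"
proof -
  define P :: "(nat \<Rightarrow> int) measure" where "P = Pi\<^sub>M {1..} (\<lambda>_. count_space UNIV)"
  define Q :: "(int \<Rightarrow> real) measure" where "Q = Pi\<^sub>M UNIV (\<lambda>_. borel)"
  have "{f \<in> space P. (\<lambda>i. walk (\<lambda>i f. f i) i f) ` {..n} = T} \<in> sets P"
    unfolding image_eq_iff P_def by measurable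
  hence V: "(\<lambda>\<omega>. \<lambda>i\<in>{1..}. X i \<omega>) -` {f \<in> space P. (\<lambda>i. walk (\<lambda>i f. f i) i f) ` {..n} = T} \<inter> space M
      \<in> sets (vimage_algebra (space M) (\<lambda>\<omega>. \<lambda>i\<in>{1..}. X i \<omega>) P)"
    by (rule in_vimage_algebra)
  have V_eq: "(\<lambda>\<omega>. \<lambda>i\<in>{1..}. X i \<omega>) -` {f \<in> space P. (\<lambda>i. walk (\<lambda>i f. f i) i f) ` {..n} = T} \<inter> space M
      = {\<omega> \<in> space M. (\<lambda>i. walk X i \<omega>) ` {..n} = T}"
    unfolding vimage_def mem_Collect_eq walk_restrict by (auto simp: P_def space_PiM)
  have W: "(\<lambda>\<omega> s. \<xi> s \<omega>) -` {f \<in> space Q. \<forall>s\<in>T. f s \<le> x} \<inter> space M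
      \<in> sets (vimage_algebra (space M) (\<lambda>\<omega> s. \<xi> s \<omega>) Q)"
    unfolding Q_def by (intro in_vimage_algebra sets_all_le)
  have W_eq: "(\<lambda>\<omega> s. \<xi> s \<omega>) -` {f \<in> space Q. \<forall>s\<in>T. f s \<le> x} \<inter> space M
      = {\<omega> \<in> space M. \<forall>s\<in>T. \<xi> s \<omega> \<le> x}"
    by (auto simp: Q_def space_PiM)
  from indep_setD[OF indep[unfolded indep_scenery_def, folded P_def Q_def] W V]
  show ?thesis unfolding V_eq W_eq by (simp only: Int_commute)
qed

text \<open>The event is split according to the range \<open>T\<close> of the walk, and independence
  separates walk and scenery. Almost surely \<open>T\<close> is an interval, which stationarity
  moves to start at 0. On the right \<open>\<omega>\<close> is used for the walk only and
  \<open>\<omega>'\<close> for the scenery; the range is never empty, so subtracting 1 from its size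
  truncates nothing.\<close>

lemma prob_scenery_walk_le:
  "prob {\<omega> \<in> space M. \<forall>i\<in>{..n}. \<xi> (walk X i \<omega>) \<omega> \<le> x}
   = expectation (\<lambda>\<omega>. prob {\<omega>' \<in> space M.
       \<forall>s\<in>{0..int (card ((\<lambda>i. walk X i \<omega>) ` {..n}) - 1)}. \<xi> s \<omega>' \<le> x})"
proof -
  define R where "R \<omega> = (\<lambda>i. walk X i \<omega>) ` {..n}" for \<omega>
  define V where "V T = {\<omega> \<in> space M. R \<omega> = T}" for T
  define W where "W T = {\<omega> \<in> space M. \<forall>s\<in>T. \<xi> s \<omega> \<le> x}" for T
  \<comment> \<open>Unit steps keep the walk within distance \<open>n\<close> of 0, so almost surely
    the range is one of these finitely many sets.\<close>
  define \<T> where "\<T> = Pow {- int n..int n}"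
  have V [measurable]: "V T \<in> events" for T
    unfolding V_def R_def image_eq_iff by measurable
  have W [measurable]: "W T \<in> events" for T
    unfolding W_def by measurable
  have fin: "finite \<T>" by (simp add: \<T>_def)
  have disj: "disjoint_family_on (\<lambda>T. V T \<inter> W T) \<T>"
    by (auto simp: disjoint_family_on_def V_def)
  have range_AE: "AE \<omega> in M. R \<omega> \<in> \<T> \<and> (\<exists>a b. a \<le> b \<and> R \<omega> = {a..b})"
    using AE_walk_step
  proof eventually_elim
    case (elim \<omega>)
    have "\<bar>walk X i \<omega>\<bar> \<le> int i" for i
    proof (induction i)
      case 0
      show ?case by (simp add: walk_def)
    next
      case (Suc i)
      thus ?case using elim[rule_format, of i] by linarith
    qed
    hence "\<bar>walk X i \<omega>\<bar> \<le> int n" if "i \<le> n" for i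
      using that by (meson of_nat_le_iff order_trans)
    hence "R \<omega> \<in> \<T>" unfolding R_def \<T>_def by (auto simp: abs_le_iff minus_le_iff)
    moreover have "\<exists>a b. a \<le> b \<and> R \<omega> = {a..b}"
      unfolding R_def using nearest_neighbour_image_eq_interval[of "\<lambda>i. walk X i \<omega>" n] elim by blast
    ultimately show ?case ..
  qed
  have "prob {\<omega> \<in> space M. \<forall>i\<in>{..n}. \<xi> (walk X i \<omega>) \<omega> \<le> x} = prob (\<Union>T\<in>\<T>. V T \<inter> W T)"
  proof (rule measure_eq_AE)
    show "AE \<omega> in M. \<omega> \<in> {\<omega> \<in> space M. \<forall>i\<in>{..n}. \<xi> (walk X i \<omega>) \<omega> \<le> x}
        \<longleftrightarrow> \<omega> \<in> (\<Union>T\<in>\<T>. V T \<inter> W T)"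
      using range_AE AE_space by eventually_elim (auto simp: V_def W_def R_def)
    show "(\<Union>T\<in>\<T>. V T \<inter> W T) \<in> events" using fin by auto
  qed measurable
  also have "\<dots> = (\<Sum>T\<in>\<T>. prob (V T \<inter> W T))"
    by (rule finite_measure_finite_Union[OF fin _ disj]) auto
  also have "\<dots> = (\<Sum>T\<in>\<T>. prob (W T) * prob (V T))"
    unfolding V_def W_def R_def prob_range_Int_scenery ..
  also have "\<dots> = expectation (\<lambda>\<omega>. \<Sum>T\<in>\<T>. prob (W T) * indicator (V T) \<omega>)"
    by (subst Bochner_Integration.integral_sum) (auto simp: emeasure_eq_measure)
  also have "\<dots> = expectation (\<lambda>\<omega>. prob (W {0..int (card (R \<omega>) - 1)}))"
  proof (rule integral_cong_AE)
    show "(\<lambda>\<omega>. prob (W {0..int (card (R \<omega>) - 1)})) \<in> borel_measurable M"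
      unfolding R_def
      by (rule measurable_compose[OF measurable_card_range,
            where g = "\<lambda>m. prob (W {0..int (m - 1)})"]) auto
    show "AE \<omega> in M. (\<Sum>T\<in>\<T>. prob (W T) * indicator (V T) \<omega>) = prob (W {0..int (card (R \<omega>) - 1)})"
      using range_AE AE_space
    proof eventually_elim
      case (elim \<omega>)
      then obtain a b where ab: "a \<le> b" "R \<omega> = {a..b}" by blast
      \<comment> \<open>Only the term with \<open>T = R \<omega>\<close> survives.\<close>
      have "(\<Sum>T\<in>\<T>. prob (W T) * indicator (V T) \<omega>)
          = (\<Sum>T\<in>\<T>. if T = R \<omega> then prob (W T) else 0)"
        using elim by (intro sum.cong) (auto simp: V_def)
      also have "\<dots> = prob (W {a..b})" using elim fin ab by simp
      also have "\<dots> = prob (W {0..b - a})"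
        using prob_all_le_shift[of 0 a "b - a" x] by (simp add: W_def)
      also have "b - a = int (card (R \<omega>) - 1)" using ab by simp
      finally show ?case .
    qed
  qed measurable
  finally show ?thesis unfolding W_def R_def .
qed

end

theorem proposition1:
  fixes M :: "'a measure"
    and X :: "nat \<Rightarrow> 'a \<Rightarrow> int"
    and \<xi> :: "int \<Rightarrow> 'a \<Rightarrow> real"
    and u :: "real \<Rightarrow> nat \<Rightarrow> real"
    and p q \<sigma> :: real
    and k :: nat
  assumes "prob_space M"
    and "0 < p" and "p < 1" and "p \<noteq> 1 / 2"
    and "prob_space.indep_vars M (\<lambda>_. count_space UNIV) X {1..}"
    and "\<And>i. i \<ge> 1 \<Longrightarrow> measure M {\<omega> \<in> space M. X i \<omega> = 1} = p"
    and "\<And>i. i \<ge> 1 \<Longrightarrow> measure M {\<omega> \<in> space M. X i \<omega> = -1} = 1 - p"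
    and "q = measure M {\<omega> \<in> space M. \<forall>i\<ge>1. walk X i \<omega> \<noteq> 0}"
    and "stationary M \<xi>"
    and "indep_scenery M \<xi> X"
    and "\<And>\<tau> n. \<tau> > 0 \<Longrightarrow> u \<tau> n > 0"
    and "\<And>\<tau>. \<tau> > 0 \<Longrightarrow>
           (\<lambda>n. real n * measure M {\<omega> \<in> space M. \<xi> 0 \<omega> > u \<tau> n}) \<longlonglongrightarrow> \<tau>"
    and "k \<ge> 1"
    and "\<And>\<tau>. \<tau> > 0 \<Longrightarrow> D_cond k M (\<lambda>i. \<xi> (int i)) (u \<tau>)"
    and "\<And>\<tau>. \<tau> > 0 \<Longrightarrow> Delta_cond M (\<lambda>i \<omega>. \<xi> (walk X i \<omega>) \<omega>) (u \<tau>)"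
    and "0 < \<sigma>" and "\<sigma> \<le> 1"
    and "\<And>\<tau>. \<tau> > 0 \<Longrightarrow>
           (\<lambda>n. measure M {\<omega> \<in> space M. (MAX s\<in>{0..n}. \<xi> (int s) \<omega>) \<le> u \<tau> n})
             \<longlonglongrightarrow> exp (- \<sigma> * \<tau>)"
  shows "\<forall>\<tau>>0. (\<lambda>n. measure M {\<omega> \<in> space M. (MAX i\<in>{0..n}. \<xi> (walk X i \<omega>) \<omega>) \<le> u \<tau> n})
             \<longlonglongrightarrow> exp (- \<sigma> * q * \<tau>)"
proof (intro allI impI)
  fix \<tau> :: real assume "\<tau> > 0"
  interpret prob_space M by fact
  interpret walk_in_scenery M X p \<xi>
    by unfold_locales (use assms in auto)
  have q: "q = \<bar>2 * p - 1\<bar>" using assms(8) prob_no_return by simp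
  \<comment> \<open>Positivity of \<open>q\<close> is what allows
    \<open>prob_all_le_rescaled\<close> to be applied with \<open>c = q\<close>.\<close>
  have "q > 0" using q assms(4) by simp
  have MAX_le: "(MAX i\<in>{0..n}. f i) \<le> y \<longleftrightarrow> (\<forall>i\<in>{..n}. f i \<le> y)" for f :: "nat \<Rightarrow> real" and n y
    by (subst Max_le_iff) auto
  have "(\<forall>s\<in>{0..int n}. f s \<le> y) \<longleftrightarrow> (\<forall>i\<in>{..n}. f (int i) \<le> y)" for f :: "int \<Rightarrow> real" and n y
    by (metis atLeastAtMost_iff atMost_iff nat_0_le nat_int nat_mono of_nat_0_le_iff of_nat_mono)
  hence extremal: "(\<lambda>n. prob {\<omega> \<in> space M. \<forall>s\<in>{0..int n}. \<xi> s \<omega> \<le> u \<tau> n}) \<longlonglongrightarrow> exp (- \<sigma> * \<tau>)"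
    if "\<tau> > 0" for \<tau>
    using assms(18)[OF that] unfolding MAX_le by simp
  let ?H = "\<lambda>n m. prob {\<omega> \<in> space M. \<forall>s\<in>{0..int m}. \<xi> s \<omega> \<le> u \<tau> n}"
  let ?R = "\<lambda>n \<omega>. card ((\<lambda>i. walk X i \<omega>) ` {..n})"
  have "(\<lambda>n. expectation (\<lambda>\<omega>. ?H n (?R n \<omega> - 1))) \<longlonglongrightarrow> expectation (\<lambda>_. exp (- \<sigma> * q * \<tau>))"
  \<comment> \<open>The integrand is a probability, hence bounded by 1.\<close>
  proof (rule integral_dominated_convergence[where w = "\<lambda>_. 1"])
    show "AE \<omega> in M. (\<lambda>n. ?H n (?R n \<omega> - 1)) \<longlonglongrightarrow> exp (- \<sigma> * q * \<tau>)"
      using AE_range_growth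
    proof eventually_elim
      case (elim \<omega>)
      have pos: "?R n \<omega> \<ge> 1" for n by (simp add: Suc_le_eq card_gt_0_iff)
      \<comment> \<open>A range of \<open>?R n \<omega>\<close> sites is shifted to
        \<open>{0..?R n \<omega> - 1}\<close>, so the rescaling uses
        \<open>m n = ?R n \<omega> - 1\<close>; the missing 1 disappears after division by
        \<open>n\<close>.\<close>
      have "(\<lambda>n. real (?R n \<omega>) / real n - 1 / real n) \<longlonglongrightarrow> q - 0"
        using elim unfolding q by (intro tendsto_diff lim_1_over_n)
      moreover have "real (?R n \<omega>) / real n - 1 / real n = real (?R n \<omega> - 1) / real n" for n
        using pos[of n] by (simp add: of_nat_diff diff_divide_distrib)
      ultimately have "(\<lambda>n. real (?R n \<omega> - 1) / real n) \<longlonglongrightarrow> q" by simp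
      from prob_all_le_rescaled[of u, OF _ _ this \<open>q > 0\<close> \<open>\<tau> > 0\<close>]
      show ?case using assms(12) extremal by blast
    qed
    show "(\<lambda>\<omega>. ?H n (?R n \<omega> - 1)) \<in> borel_measurable M" for n
      by (rule measurable_compose[OF measurable_card_range, of _ borel]) auto
  qed auto
  thus "(\<lambda>n. measure M {\<omega> \<in> space M. (MAX i\<in>{0..n}. \<xi> (walk X i \<omega>) \<omega>) \<le> u \<tau> n})
      \<longlonglongrightarrow> exp (- \<sigma> * q * \<tau>)"
    unfolding MAX_le prob_scenery_walk_le by (simp add: prob_space)
qed

end
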